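(* There is no algorithm (deterministic or randomized) for the Search on Trees problem that has expected query complexity $O(\log \mathrm{dist}(s,t))$ for every tree $T=(V,E)$, every prediction $s \in V$ and every target $t \in V$.
   Context: Search on Trees problem: we are given a finite tree $T=(V,E)$ and a prediction $s\in V$; there is an unknown target node $t\in V$. The algorithm may adaptively query any node $x\in V$; the query returns "here" if $x=t$, and otherwise returns the unique neighbor of $x$ lying on the (unique) path in $T$ from $x$ to $t$. The algorithm must always output (find) $t$; its query complexity is the number of queries made (for randomized algorithms, the expected number over the algorithm's internal randomness). $\mathrm{dist}(s,t)$ denotes the number of edges on the path in $T$ between $s$ and $t$. *)

theory Defs
  imports "HOL-Probability.Probability" "HOL-Library.Infinite_Typeclass"
begin

text \<open>
  Undirected simple graphs are pairs of a vertex set and a set of two-element edges.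
  The predicate \<open>tree\<close> of the AFP entry Graph\_Theory excludes only directed cycles, so
  it is not the notion of an undirected tree and is not used here.
\<close>

type_synonym 'v ugraph = "'v set \<times> 'v set set"

abbreviation nodes :: "'v ugraph \<Rightarrow> 'v set" where
  "nodes T \<equiv> fst T"

abbreviation edges :: "'v ugraph \<Rightarrow> 'v set set" where
  "edges T \<equiv> snd T"

definition simple_graph :: "'v ugraph \<Rightarrow> bool" where
  "simple_graph T \<longleftrightarrow> (\<forall>e\<in>edges T. \<exists>x\<in>nodes T. \<exists>y\<in>nodes T. x \<noteq> y \<and> e = {x, y})"

definition path_between :: "'v ugraph \<Rightarrow> 'v \<Rightarrow> 'v \<Rightarrow> 'v list \<Rightarrow> bool" where
  "path_between T x y p \<longleftrightarrow>
     p \<noteq> [] \<and> hd p = x \<and> last p = y \<and> set p \<subseteq> nodes T \<and> distinct p \<and>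
     successively (\<lambda>u v. {u, v} \<in> edges T) p"

definition is_cycle :: "'v ugraph \<Rightarrow> 'v list \<Rightarrow> bool" where
  "is_cycle T c \<longleftrightarrow>
     3 \<le> length c \<and> distinct c \<and> successively (\<lambda>u v. {u, v} \<in> edges T) c \<and>
     {last c, hd c} \<in> edges T"

definition finite_tree :: "'v ugraph \<Rightarrow> bool" where
  "finite_tree T \<longleftrightarrow>
     finite (nodes T) \<and> nodes T \<noteq> {} \<and> simple_graph T \<and>
     (\<forall>x\<in>nodes T. \<forall>y\<in>nodes T. \<exists>p. path_between T x y p) \<and>
     (\<nexists>c. is_cycle T c)"

definition tree_path :: "'v ugraph \<Rightarrow> 'v \<Rightarrow> 'v \<Rightarrow> 'v list" where
  "tree_path T x y = (THE p. path_between T x y p)"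

definition tree_dist :: "'v ugraph \<Rightarrow> 'v \<Rightarrow> 'v \<Rightarrow> nat" where
  "tree_dist T x y = length (tree_path T x y) - 1"

datatype 'v answer = Here | Toward 'v

definition respond :: "'v ugraph \<Rightarrow> 'v \<Rightarrow> 'v \<Rightarrow> 'v answer" where
  "respond T t x = (if x = t then Here else Toward (tree_path T x t ! 1))"

text \<open>
  A strategy maps the queries asked so far, with their answers (oldest first), to its next
  move. It may output the target without having queried it. A deterministic algorithm
  yields a strategy for every tree and prediction.
\<close>

datatype 'v move = Query 'v | Output 'v

type_synonym 'v strategy = "('v \<times> 'v answer) list \<Rightarrow> 'v move"

type_synonym 'v algorithm = "'v ugraph \<Rightarrow> 'v \<Rightarrow> 'v strategy"

text \<open>The history after \<open>n\<close> moves; it no longer changes once an output has been made.\<close>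

primrec transcript :: "'v strategy \<Rightarrow> ('v \<Rightarrow> 'v answer) \<Rightarrow> nat \<Rightarrow> ('v \<times> 'v answer) list" where
  "transcript \<sigma> r 0 = []"
| "transcript \<sigma> r (Suc n) =
     (case \<sigma> (transcript \<sigma> r n) of
        Query x \<Rightarrow> transcript \<sigma> r n @ [(x, r x)]
      | Output _ \<Rightarrow> transcript \<sigma> r n)"

definition outputs :: "'v strategy \<Rightarrow> ('v \<Rightarrow> 'v answer) \<Rightarrow> 'v \<Rightarrow> bool" where
  "outputs \<sigma> r v \<longleftrightarrow> (\<exists>n. \<sigma> (transcript \<sigma> r n) = Output v)"

definition num_queries :: "'v strategy \<Rightarrow> ('v \<Rightarrow> 'v answer) \<Rightarrow> ennreal" where
  "num_queries \<sigma> r = (SUP n. of_nat (length (transcript \<sigma> r n)))"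

definition deterministic_search :: "'v algorithm \<Rightarrow> bool" where
  "deterministic_search A \<longleftrightarrow>
     (\<forall>T s. finite_tree T \<longrightarrow> s \<in> nodes T \<longrightarrow>
        (\<forall>h. A T s h \<in> Query ` nodes T \<union> Output ` nodes T) \<and>
        (\<forall>t\<in>nodes T. outputs (A T s) (respond T t) t))"

definition query_complexity :: "'v algorithm \<Rightarrow> 'v ugraph \<Rightarrow> 'v \<Rightarrow> 'v \<Rightarrow> ennreal" where
  "query_complexity A T s t = num_queries (A T s) (respond T t)"

text \<open>
  A randomized algorithm is a deterministic one that depends on a random seed, drawn from
  an arbitrary probability space. It is errorless: every seed leads to the target.
\<close>

definition randomized_search :: "'w measure \<Rightarrow> ('w \<Rightarrow> 'v algorithm) \<Rightarrow> bool" where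
  "randomized_search M A \<longleftrightarrow>
     prob_space M \<and>
     (\<forall>\<omega>\<in>space M. deterministic_search (A \<omega>)) \<and>
     (\<forall>T s h. finite_tree T \<longrightarrow> s \<in> nodes T \<longrightarrow>
        (\<lambda>\<omega>. A \<omega> T s h) \<in> M \<rightarrow>\<^sub>M count_space UNIV)"

definition expected_query_complexity ::
  "'w measure \<Rightarrow> ('w \<Rightarrow> 'v algorithm) \<Rightarrow> 'v ugraph \<Rightarrow> 'v \<Rightarrow> 'v \<Rightarrow> ennreal" where
  "expected_query_complexity M A T s t = (\<integral>\<^sup>+ \<omega>. query_complexity (A \<omega>) T s t \<partial>M)"

text \<open>
  \<open>O(log dist(s,t))\<close> as the distance grows, uniformly in the instance. The threshold
  \<open>d0\<close> is needed because the logarithm vanishes at distance one.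
\<close>

definition bigo_log_dist :: "('v ugraph \<Rightarrow> 'v \<Rightarrow> 'v \<Rightarrow> ennreal) \<Rightarrow> bool" where
  "bigo_log_dist f \<longleftrightarrow>
     (\<exists>(C::real) (d0::nat). \<forall>T s t.
        finite_tree T \<longrightarrow> s \<in> nodes T \<longrightarrow> t \<in> nodes T \<longrightarrow> d0 \<le> tree_dist T s t \<longrightarrow>
        f T s t \<le> ennreal (C * ln (real (tree_dist T s t))))"

end

theory Submission
  imports Defs "HOL-Real_Asymp.Real_Asymp"
begin

text \<open>
  Take the complete binary tree of depth \<open>d = 2k + 1\<close> with the prediction at the root. All
  \<open>2 ^ d\<close> leaves are at distance \<open>d\<close>, and a query has at most four different answers because
  nodes have degree at most three. Hence a deterministic strategy has at most \<open>4 ^ k\<close> transcripts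
  of length \<open>k\<close> and finds at most half of the leaves within \<open>k\<close> queries, so it makes at least
  \<open>k / 2\<close> queries on average over the leaves. Averaging over the seed as well, some leaf has
  expected complexity at least \<open>k / 2\<close>, which is not \<open>O(log d)\<close>.
\<close>

section \<open>Rooted trees given by a parent function\<close>

lemma path_between_rev:
  assumes "path_between T x y p"
  shows "path_between T y x (rev p)"
  using assms unfolding path_between_def
  by (auto simp: hd_rev last_rev insert_commute)

lemma path_between_nth_1:
  assumes "path_between T x y p" "x \<noteq> y"
  shows "{x, p ! 1} \<in> edges T"
proof -
  obtain a q where p: "p = a # q"
    using assms by (cases p) (auto simp: path_between_def)
  with assms show ?thesis
    by (cases q) (auto simp: path_between_def)
qed

lemma path_between_self:
  assumes "path_between T x x p"
  shows "p = [x]"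
  using assms by (cases p) (auto simp: path_between_def split: if_splits)

text \<open>\<open>depth\<close> makes every chain of parents end in \<open>root\<close>, so
  induction on depth can replace reasoning about general graphs.\<close>

locale rooted_tree =
  fixes V :: "'v set" and root :: 'v and par :: "'v \<Rightarrow> 'v" and depth :: "'v \<Rightarrow> nat"
  assumes finite_nodes: "finite V"
    and root_in: "root \<in> V"
    and depth_root: "depth root = 0"
    and par_in: "\<And>x. x \<in> V \<Longrightarrow> x \<noteq> root \<Longrightarrow> par x \<in> V"
    and depth_par: "\<And>x. x \<in> V \<Longrightarrow> x \<noteq> root \<Longrightarrow> depth x = Suc (depth (par x))"
begin

definition graph :: "'v ugraph" where
  "graph = (V, {{x, par x} | x. x \<in> V \<and> x \<noteq> root})"

lemma nodes_graph [simp]: "nodes graph = V"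
  by (simp add: graph_def)

lemma edge_iff:
  "{u, v} \<in> edges graph \<longleftrightarrow>
     (u \<in> V \<and> u \<noteq> root \<and> v = par u) \<or> (v \<in> V \<and> v \<noteq> root \<and> u = par v)"
  unfolding graph_def by (auto simp: doubleton_eq_iff)

lemma edge_in_nodes:
  assumes "{u, v} \<in> edges graph"
  shows "u \<in> V" "v \<in> V"
  using assms par_in by (auto simp: edge_iff)

text \<open>A path that has started to descend away from the root cannot turn back,
  since it would have to return through the parent it came from.\<close>

lemma depth_less_last:
  assumes "successively (\<lambda>u v. {u, v} \<in> edges graph) (x # y # ws)"
    and "distinct (x # y # ws)" "depth x < depth y"
  shows "depth x < depth (last (y # ws))"
  using assms
proof (induction ws arbitrary: x y)
  case Nil
  then show ?case by simp
next
  case (Cons z ws)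
  have xy: "x = par y"
    using Cons.prems depth_par by (fastforce simp: edge_iff)
  have "depth y < depth z"
    using Cons.prems xy depth_par[of z] by (auto simp: edge_iff)
  then have "depth y < depth (last (z # ws))"
    using Cons.IH[of y z] Cons.prems by simp
  then show ?case
    using Cons.prems(3) by simp
qed

section \<open>Existence and uniqueness of paths, acyclicity\<close>

lemma not_root_if_depth_le:
  assumes "x \<noteq> y" "depth y \<le> depth x" "y \<in> V"
  shows "x \<noteq> root"
  using assms depth_par[of y] by (auto simp: depth_root)

text \<open>A first step to a child would trap the path below \<open>x\<close>: by
  \<open>depth_less_last\<close> it would end strictly deeper than \<open>x\<close>, contrary to
  \<open>le\<close>.\<close>

lemma path_via_parent:
  assumes p: "path_between graph x y p" and "x \<noteq> y" and le: "depth y \<le> depth x"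
  obtains q where "p = x # q" "path_between graph (par x) y q"
proof -
  obtain z q where pz: "p = x # z # q"
    using p \<open>x \<noteq> y\<close> unfolding path_between_def by (cases p; cases "tl p") auto
  have "\<not> depth x < depth z"
    using depth_less_last[of x z q] p le pz by (auto simp: path_between_def)
  moreover have "{x, z} \<in> edges graph"
    using p pz by (auto simp: path_between_def)
  ultimately have "z = par x"
    using depth_par[of z] by (auto simp: edge_iff)
  then show thesis
    using p pz by (intro that[of "z # q"]) (auto simp: path_between_def)
qed

text \<open>Both paths must leave the deeper endpoint through its parent, so removing that endpoint
  lowers the depth sum; reversal handles the other order.\<close>

lemma path_between_unique:
  assumes "path_between graph x y p" "path_between graph x y q"
  shows "p = q"
  using assms
proof (induction "depth x + depth y" arbitrary: x y p q rule: less_induct)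
  case less
  have in_V: "x \<in> V" "y \<in> V"
    using less.prems by (auto simp: path_between_def)
  \<comment> \<open>Fresh endpoints with the same depth sum, so that the claim serves both for
    \<open>x\<close>, \<open>y\<close> and for the swapped pair.\<close>
  have *: "p' = q'"
    if neq: "x' \<noteq> y'" and le: "depth y' \<le> depth x'"
      and sum: "depth x' + depth y' = depth x + depth y"
      and in_V': "x' \<in> V" "y' \<in> V"
      and p': "path_between graph x' y' p'" and q': "path_between graph x' y' q'"
    for x' y' p' q'
  proof -
    obtain p1 where p1: "p' = x' # p1" "path_between graph (par x') y' p1"
      by (rule path_via_parent[OF p' neq le])
    obtain q1 where q1: "q' = x' # q1" "path_between graph (par x') y' q1"
      by (rule path_via_parent[OF q' neq le])
    have "depth x' = Suc (depth (par x'))"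
      using depth_par[OF in_V'(1) not_root_if_depth_le[OF neq le in_V'(2)]] .
    then have "p1 = q1"
      using less.hyps[of "par x'" y' p1 q1] p1 q1 sum by simp
    then show ?thesis
      using p1 q1 by simp
  qed
  consider "x = y" | "x \<noteq> y" "depth y \<le> depth x" | "x \<noteq> y" "depth x \<le> depth y"
    by linarith
  then show ?case
  proof cases
    case 1
    then show ?thesis
      using less.prems path_between_self by metis
  next
    case 2
    then show ?thesis
      using * less.prems in_V by blast
  next
    case 3
    then have "rev p = rev q"
      using *[of y x "rev p" "rev q"] less.prems in_V path_between_rev by (metis add.commute)
    then show ?thesis by simp
  qed
qed

lemma path_between_exists:
  assumes "x \<in> V" "y \<in> V"
  shows "\<exists>p. path_between graph x y p"
proof -
  \<comment> \<open>The depth bound strengthens the induction: it keeps a newly prepended endpoint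
    off the path already built.\<close>
  define bounded where "bounded = (\<lambda>x y p. path_between graph x y p \<and>
    (\<forall>z\<in>set p. z = x \<or> z = y \<or> depth z < max (depth x) (depth y)))"
  have "\<exists>p. bounded x y p"
    using assms
  proof (induction "depth x + depth y" arbitrary: x y rule: less_induct)
    case less
    have *: "\<exists>p. bounded x' y' p"
      if neq: "x' \<noteq> y'" and le: "depth y' \<le> depth x'"
        and sum: "depth x' + depth y' = depth x + depth y"
        and in_V': "x' \<in> V" "y' \<in> V" for x' y'
    proof -
      have nr: "x' \<noteq> root"
        using not_root_if_depth_le[OF neq le in_V'(2)] .
      have d: "depth x' = Suc (depth (par x'))" and in_V: "par x' \<in> V"
        using depth_par par_in in_V' nr by blast+
      obtain p where p: "path_between graph (par x') y' p"
          "\<forall>z\<in>set p. z = par x' \<or> z = y' \<or> depth z < max (depth (par x')) (depth y')"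
        using less.hyps[of "par x'" y'] d sum in_V in_V' unfolding bounded_def by auto
      \<comment> \<open>Every node of \<open>p\<close> other than \<open>y'\<close> has smaller
        depth than \<open>x'\<close>.\<close>
      have "x' \<notin> set p"
        using p(2) d neq le by auto
      moreover have "{x', hd p} \<in> edges graph"
        using p(1) nr in_V' by (auto simp: path_between_def edge_iff)
      ultimately have "path_between graph x' y' (x' # p)"
        using p(1) in_V' by (auto simp: path_between_def successively_Cons)
      moreover have "\<forall>z\<in>set (x' # p). z = x' \<or> z = y' \<or> depth z < max (depth x') (depth y')"
        using p(2) d by fastforce
      ultimately show ?thesis
        unfolding bounded_def by blast
    qed
    consider "x = y" | "x \<noteq> y" "depth y \<le> depth x" | "x \<noteq> y" "depth x \<le> depth y"
      by linarith
    then show ?case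
    proof cases
      case 1
      then have "bounded x y [x]"
        using less.prems by (auto simp: bounded_def path_between_def)
      then show ?thesis by blast
    next
      case 2
      then show ?thesis
        using * less.prems by blast
    next
      case 3
      then obtain p where "bounded y x p"
        using *[of y x] less.prems by auto
      then have "bounded x y (rev p)"
        unfolding bounded_def by (auto simp: max.commute intro: path_between_rev)
      then show ?thesis by blast
    qed
  qed
  then show ?thesis
    unfolding bounded_def by blast
qed

text \<open>The closing edge would be a second path between the ends of the cycle, with two nodes
  instead of at least three, against uniqueness.\<close>

lemma acyclic: "\<not> is_cycle graph c"
proof
  assume c: "is_cycle graph c"
  have len: "3 \<le> length c"
    using c by (simp add: is_cycle_def)
  \<comment> \<open>\<open>is_cycle\<close> speaks only of edges, while \<open>path_between\<close>
    asks for nodes. Each vertex has an edge from its predecessor, the first one from the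
    last.\<close>
  have "set c \<subseteq> V"
  proof
    fix v assume "v \<in> set c"
    then obtain i where i: "i < length c" "v = c ! i"
      by (auto simp: in_set_conv_nth)
    show "v \<in> V"
    proof (cases i)
      case 0
      then have "v = hd c"
        using i len by (cases c) auto
      then show ?thesis
        using c edge_in_nodes by (auto simp: is_cycle_def)
    next
      case (Suc j)
      then have "{c ! j, v} \<in> edges graph"
        using c i unfolding is_cycle_def successively_conv_nth by auto
      then show ?thesis
        by (rule edge_in_nodes)
    qed
  qed
  then have "path_between graph (hd c) (last c) c"
    using c by (auto simp: is_cycle_def path_between_def)
  moreover have "path_between graph (hd c) (last c) [hd c, last c]"
  proof -
    have "hd c \<noteq> last c"
      using c by (cases c) (auto simp: is_cycle_def)
    moreover have "{hd c, last c} \<in> edges graph"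
      using c by (simp add: is_cycle_def insert_commute)
    ultimately show ?thesis
      using edge_in_nodes by (auto simp: path_between_def)
  qed
  ultimately have "c = [hd c, last c]"
    by (rule path_between_unique)
  then have "length c = 2"
    by (metis length_Cons list.size(3) numeral_2_eq_2)
  then show False
    using len by simp
qed

lemma finite_tree_graph: "finite_tree graph"
proof -
  have "simple_graph graph"
    unfolding simple_graph_def
  proof
    fix e assume "e \<in> edges graph"
    then obtain x where x: "x \<in> V" "x \<noteq> root" "e = {x, par x}"
      by (auto simp: graph_def)
    moreover have "x \<noteq> par x"
      using depth_par[OF x(1,2)] by auto
    ultimately show "\<exists>x\<in>nodes graph. \<exists>y\<in>nodes graph. x \<noteq> y \<and> e = {x, y}"
      using par_in by auto
  qed
  then show ?thesis
    using finite_nodes root_in path_between_exists acyclic by (auto simp: finite_tree_def)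
qed

section \<open>Distances from the root and possible answers\<close>

lemma path_between_tree_path:
  assumes "x \<in> V" "y \<in> V"
  shows "path_between graph x y (tree_path graph x y)"
  unfolding tree_path_def
  using path_between_exists[OF assms] path_between_unique by (metis theI)

text \<open>Since \<open>root\<close> has depth 0, \<open>path_via_parent\<close> applies at every
  step: the path climbs one level at a time.\<close>

lemma length_path_to_root:
  assumes "path_between graph x root p"
  shows "length p = Suc (depth x)"
  using assms
proof (induction "depth x" arbitrary: x p rule: less_induct)
  case less
  have in_V: "x \<in> V"
    using less.prems by (auto simp: path_between_def)
  show ?case
  proof (cases "x = root")
    case True
    then show ?thesis
      using less.prems path_between_self depth_root by fastforce
  next
    case False
    then obtain q where "p = x # q" "path_between graph (par x) root q"
      using path_via_parent[OF less.prems] depth_root by auto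
    then show ?thesis
      using less.hyps[of "par x" q] depth_par[OF in_V False] by simp
  qed
qed

lemma tree_dist_root:
  assumes "x \<in> V"
  shows "tree_dist graph root x = depth x"
  using length_path_to_root[OF path_between_rev[OF path_between_tree_path[OF root_in assms]]]
  by (simp add: tree_dist_def)

text \<open>A negative answer is the second node of a path, hence a neighbour of \<open>x\<close>:
  its parent or a child.\<close>

lemma respond_cases:
  assumes "x \<in> V" "t \<in> V"
  shows "respond graph t x \<in> insert Here (Toward ` insert (par x) {y \<in> V. y \<noteq> root \<and> par y = x})"
  using path_between_nth_1[OF path_between_tree_path[OF assms]]
  by (auto simp: respond_def edge_iff)

end

section \<open>Complete binary trees\<close>

text \<open>Nodes are words over the booleans, embedded into the given vertex type.\<close>

lemma rooted_tree_words:
  fixes f :: "bool list \<Rightarrow> 'v"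
  assumes f: "inj f"
  shows "rooted_tree (f ` {w. length w \<le> d}) (f []) (\<lambda>v. f (tl (inv f v))) (\<lambda>v. length (inv f v))"
proof
  show "finite (f ` {w. length w \<le> d})"
    using finite_lists_length_le[of "UNIV :: bool set" d] by simp
qed (use f in \<open>auto simp: inj_eq\<close>)

lemma binary_tree_exists:
  obtains T :: "'v::infinite ugraph" and s L where
    "finite_tree T" "s \<in> nodes T" "L \<subseteq> nodes T" "card L = 2 ^ d"
    "\<And>t. t \<in> L \<Longrightarrow> tree_dist T s t = d"
    "\<And>x. x \<in> nodes T \<Longrightarrow> \<exists>S. finite S \<and> card S \<le> 4 \<and> (\<forall>t\<in>nodes T. respond T t x \<in> S)"
proof -
  \<comment> \<open>An infinite vertex type contains a copy of the naturals, and
    \<open>to_nat\<close> encodes words as naturals.\<close>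
  obtain g :: "nat \<Rightarrow> 'v" where g: "inj g"
    using infinite_countable_subset[OF infinite_UNIV] by auto
  define f :: "bool list \<Rightarrow> 'v" where "f = g \<circ> to_nat"
  have f: "inj f"
    unfolding f_def using g by (intro inj_compose) auto
  interpret rooted_tree "f ` {w. length w \<le> d}" "f []"
    "\<lambda>v. f (tl (inv f v))" "\<lambda>v. length (inv f v)"
    by (rule rooted_tree_words[OF f])
  show thesis
  proof (rule that[of graph "f []" "f ` {w. length w = d}"])
    show "finite_tree graph"
      by (rule finite_tree_graph)
    show "card (f ` {w. length w = d}) = 2 ^ d"
      using card_lists_length_eq[of "UNIV :: bool set" d] f
      by (simp add: card_image inj_on_subset[OF f])
    show "tree_dist graph (f []) t = d" if "t \<in> f ` {w. length w = d}" for t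
      using that tree_dist_root[of t] f by auto
    show "\<exists>S. finite S \<and> card S \<le> 4 \<and> (\<forall>t\<in>nodes graph. respond graph t x \<in> S)"
      if "x \<in> nodes graph" for x
    proof -
      obtain w where w: "x = f w" "length w \<le> d"
        using \<open>x \<in> nodes graph\<close> by auto
      \<comment> \<open>Only an upper bound: at a leaf the two longer words are no nodes, and at the
        root \<open>tl w\<close> is the root again.\<close>
      define S where
        "S = {Here, Toward (f (tl w)), Toward (f (True # w)), Toward (f (False # w))}"
      have "respond graph t x \<in> S" if "t \<in> nodes graph" for t
      proof -
        have "y \<in> {f (True # w), f (False # w)}"
          if y: "y \<in> f ` {w. length w \<le> d}" "y \<noteq> f []" "f (tl (inv f y)) = x" for y
        proof -
          obtain u where u: "y = f u"
            using y by auto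
          with y w f have "u \<noteq> []" "tl u = w"
            by (auto simp: inj_eq)
          then show ?thesis
            using u by (cases u; cases "hd u") auto
        qed
        then have "insert Here (Toward ` insert (f (tl (inv f x)))
            {y \<in> f ` {w. length w \<le> d}. y \<noteq> f [] \<and> f (tl (inv f y)) = x}) \<subseteq> S"
          using w(1) f unfolding S_def by fastforce
        then show ?thesis
          using respond_cases[of x t] \<open>x \<in> nodes graph\<close> that by auto
      qed
      moreover have "finite S" "card S \<le> 4"
        unfolding S_def by (auto simp: card_insert_if)
      ultimately show ?thesis by blast
    qed
  qed auto
qed

section \<open>Counting transcripts\<close>

text \<open>A query extends a transcript by one of at most \<open>b\<close> answers; an output
  leaves it unchanged, which \<open>1 \<le> b\<close> covers.\<close>

lemma card_transcripts_le:
  assumes "finite X"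
    and "\<And>h x. \<sigma> h = Query x \<Longrightarrow> \<exists>S. finite S \<and> card S \<le> b \<and> (\<forall>t\<in>X. r t x \<in> S)"
    and "1 \<le> b"
  shows "card ((\<lambda>t. transcript \<sigma> (r t) k) ` X) \<le> b ^ k"
proof (induction k)
  case 0
  show ?case
    by (simp add: image_constant_conv)
next
  case (Suc k)
  define R where "R = (\<lambda>t. transcript \<sigma> (r t) k) ` X"
  define ext where "ext = (\<lambda>h. (\<lambda>t. case \<sigma> h of Query x \<Rightarrow> h @ [(x, r t x)] | Output _ \<Rightarrow> h) ` X)"
  have card_ext: "card (ext h) \<le> b" for h
  proof (cases "\<sigma> h")
    case (Query x)
    then obtain S where S: "finite S" "card S \<le> b" "\<forall>t\<in>X. r t x \<in> S"
      using assms by blast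
    then have "ext h \<subseteq> (\<lambda>a. h @ [(x, a)]) ` S"
      by (auto simp: ext_def Query)
    then have "card (ext h) \<le> card S"
      using S(1) by (rule surj_card_le[rotated])
    then show ?thesis
      using S by simp
  next
    case (Output v)
    then have "ext h \<subseteq> {h}"
      by (auto simp: ext_def)
    then have "card (ext h) \<le> 1"
      using card_mono[of "{h}" "ext h"] by simp
    then show ?thesis
      using \<open>1 \<le> b\<close> by simp
  qed
  have "(\<lambda>t. transcript \<sigma> (r t) (Suc k)) ` X \<subseteq> (\<Union>h\<in>R. ext h)"
    by (auto simp: R_def ext_def)
  moreover have fin: "finite R" "\<And>h. finite (ext h)"
    using assms(1) by (auto simp: R_def ext_def)
  ultimately have "card ((\<lambda>t. transcript \<sigma> (r t) (Suc k)) ` X) \<le> card (\<Union>h\<in>R. ext h)"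
    by (intro card_mono) auto
  also have "\<dots> \<le> (\<Sum>h\<in>R. card (ext h))"
    by (rule card_UN_le[OF fin(1)])
  also have "\<dots> \<le> (\<Sum>h\<in>R. b)"
    by (rule sum_mono) (rule card_ext)
  also have "\<dots> \<le> b ^ Suc k"
    using Suc.IH by (simp add: R_def)
  finally show ?case .
qed

section \<open>Outputs and the number of queries\<close>

lemma transcript_stable:
  assumes "\<sigma> (transcript \<sigma> r n) = Output v" "n \<le> m"
  shows "transcript \<sigma> r m = transcript \<sigma> r n"
  using assms(2)
proof (induction rule: dec_induct)
  case base
  then show ?case by simp
next
  case (step m)
  then show ?case using assms(1) by simp
qed

lemma output_unique:
  assumes "\<sigma> (transcript \<sigma> r n) = Output v" "\<sigma> (transcript \<sigma> r m) = Output w"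
  shows "v = w"
proof (cases "n \<le> m")
  case True
  then show ?thesis
    using transcript_stable[of \<sigma> r n v m] assms by simp
next
  case False
  then show ?thesis
    using transcript_stable[of \<sigma> r m w n] assms by simp
qed

text \<open>Outputs are permanent, so if the move after \<open>transcript \<sigma> r n\<close> is a
  query, all earlier moves were queries too, each adding one entry.\<close>

lemma output_or_length_transcript:
  "(\<exists>v. \<sigma> (transcript \<sigma> r n) = Output v) \<or> length (transcript \<sigma> r (Suc n)) = Suc n"
proof (induction n)
  case 0
  then show ?case by (cases "\<sigma> []") auto
next
  case (Suc n)
  show ?case
  proof (cases "\<sigma> (transcript \<sigma> r (Suc n))")
    case (Query x)
    have "\<not> (\<exists>v. \<sigma> (transcript \<sigma> r n) = Output v)"
      using Query transcript_stable[of \<sigma> r n _ "Suc n"] by auto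
    then have "length (transcript \<sigma> r (Suc n)) = Suc n"
      using Suc.IH by blast
    moreover have "transcript \<sigma> r (Suc (Suc n)) = transcript \<sigma> r (Suc n) @ [(x, r x)]"
      using Query by (simp only: transcript.simps(2)[of \<sigma> r "Suc n"]) simp
    ultimately show ?thesis by simp
  qed simp
qed

lemma output_within_num_queries:
  assumes "num_queries \<sigma> r \<le> of_nat k" "outputs \<sigma> r v"
  shows "\<sigma> (transcript \<sigma> r k) = Output v"
proof -
  \<comment> \<open>The supremum is tested at \<open>Suc k\<close>, where a further query would give
    length \<open>k + 1\<close>.\<close>
  have "of_nat (length (transcript \<sigma> r (Suc k))) \<le> (of_nat k :: ennreal)"
    using assms(1) unfolding num_queries_def by (rule order.trans[OF SUP_upper, rotated]) simp
  then have "length (transcript \<sigma> r (Suc k)) \<le> k"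
    by simp
  then obtain w where w: "\<sigma> (transcript \<sigma> r k) = Output w"
    using output_or_length_transcript[of \<sigma> r k] by auto
  then show ?thesis
    using assms(2) output_unique unfolding outputs_def by metis
qed

text \<open>For these targets the move after \<open>k\<close> steps outputs the target itself. The
  transcript determines that move, hence the target, so there are no more targets than
  transcripts.\<close>

lemma card_found_within:
  assumes "finite X" "1 \<le> b"
    and "\<And>h x. \<sigma> h = Query x \<Longrightarrow> \<exists>S. finite S \<and> card S \<le> b \<and> (\<forall>t\<in>X. r t x \<in> S)"
    and "\<And>t. t \<in> X \<Longrightarrow> outputs \<sigma> (r t) t"
  shows "card {t \<in> X. num_queries \<sigma> (r t) \<le> of_nat k} \<le> b ^ k"
proof -
  let ?F = "{t \<in> X. num_queries \<sigma> (r t) \<le> of_nat k}"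
  have "inj_on (\<lambda>t. transcript \<sigma> (r t) k) ?F"
  proof (rule inj_onI)
    fix t u assume *: "t \<in> ?F" "u \<in> ?F" "transcript \<sigma> (r t) k = transcript \<sigma> (r u) k"
    then have "\<sigma> (transcript \<sigma> (r t) k) = Output t" "\<sigma> (transcript \<sigma> (r u) k) = Output u"
      using output_within_num_queries assms(4) by fast+
    then show "t = u"
      by (metis *(3) move.inject(2))
  qed
  then have "card ?F = card ((\<lambda>t. transcript \<sigma> (r t) k) ` ?F)"
    by (simp add: card_image)
  also have "\<dots> \<le> card ((\<lambda>t. transcript \<sigma> (r t) k) ` X)"
    using assms(1) by (intro card_mono) auto
  also have "\<dots> \<le> b ^ k"
    using card_transcripts_le[OF assms(1) assms(3) assms(2)] .
  finally show ?thesis .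
qed

text \<open>Targets needing more than \<open>k\<close> queries count as \<open>k\<close>, the others
  as 0. The subtraction is truncated, so the bound is trivial once \<open>b ^ k\<close> reaches
  \<open>card X\<close>.\<close>

lemma sum_num_queries_ge:
  assumes "finite X" "1 \<le> b"
    and "\<And>h x. \<sigma> h = Query x \<Longrightarrow> \<exists>S. finite S \<and> card S \<le> b \<and> (\<forall>t\<in>X. r t x \<in> S)"
    and "\<And>t. t \<in> X \<Longrightarrow> outputs \<sigma> (r t) t"
  shows "of_nat (k * (card X - b ^ k)) \<le> (\<Sum>t\<in>X. num_queries \<sigma> (r t))"
proof -
  let ?F = "{t \<in> X. num_queries \<sigma> (r t) \<le> of_nat k}"
  have "card X - b ^ k \<le> card X - card ?F"
    using card_found_within[OF assms] by (intro diff_le_mono2)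
  also have "\<dots> = card (X - ?F)"
    using assms(1) by (subst card_Diff_subset) auto
  finally have "k * (card X - b ^ k) \<le> card (X - ?F) * k"
    by (simp add: mult.commute)
  then have "(of_nat (k * (card X - b ^ k)) :: ennreal) \<le> of_nat (card (X - ?F) * k)"
    by (simp only: of_nat_le_iff)
  also have "\<dots> = (\<Sum>t\<in>X - ?F. of_nat k)"
    by simp
  also have "\<dots> \<le> (\<Sum>t\<in>X - ?F. num_queries \<sigma> (r t))"
    by (rule sum_mono) auto
  also have "\<dots> \<le> (\<Sum>t\<in>X. num_queries \<sigma> (r t))"
    using assms(1) by (intro sum_mono2) auto
  finally show ?thesis .
qed

section \<open>Randomized search\<close>

text \<open>The seed enters each step twice, through the transcript and through the strategy applied
  to it. As transcripts take countably many values, it suffices to treat each fixed history.\<close>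

lemma measurable_transcript:
  fixes \<sigma> :: "'w \<Rightarrow> 'v strategy"
  assumes "countable V"
    and "\<And>\<omega> h x. \<omega> \<in> space M \<Longrightarrow> \<sigma> \<omega> h = Query x \<Longrightarrow> x \<in> V"
    and "\<And>h. (\<lambda>\<omega>. \<sigma> \<omega> h) \<in> M \<rightarrow>\<^sub>M count_space UNIV"
  shows "(\<lambda>\<omega>. transcript (\<sigma> \<omega>) r n) \<in> M \<rightarrow>\<^sub>M count_space UNIV"
proof (induction n)
  case 0
  show ?case by simp
next
  case (Suc n)
  let ?I = "lists ((\<lambda>x. (x, r x)) ` V)"
  let ?step = "\<lambda>h m. case m of Query x \<Rightarrow> h @ [(x, r x)] | Output _ \<Rightarrow> h"
  \<comment> \<open>Queries lie in \<open>V\<close> and \<open>r\<close> fixes the answers, so the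
    transcripts lie in a countable set even if the vertex type is uncountable.\<close>
  have "transcript (\<sigma> \<omega>) r n \<in> ?I" if "\<omega> \<in> space M" for \<omega>
    using assms(2)[OF that] by (induction n) (auto split: move.split)
  then have "(\<lambda>\<omega>. transcript (\<sigma> \<omega>) r n) \<in> M \<rightarrow>\<^sub>M restrict_space (count_space UNIV) ?I"
    using Suc.IH by (intro measurable_restrict_space2) auto
  then have I: "(\<lambda>\<omega>. transcript (\<sigma> \<omega>) r n) \<in> M \<rightarrow>\<^sub>M count_space ?I"
    by (simp add: restrict_count_space)
  have "countable ?I"
    using assms(1) by simp
  moreover have "(\<lambda>\<omega>. ?step h (\<sigma> \<omega> h)) \<in> M \<rightarrow>\<^sub>M count_space UNIV" for h
    by (rule measurable_compose[OF assms(3)]) simp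
  ultimately show ?case
    using measurable_compose_countable'[OF _ I, of "\<lambda>h \<omega>. ?step h (\<sigma> \<omega> h)"] by simp
qed

lemma borel_measurable_num_queries:
  fixes \<sigma> :: "'w \<Rightarrow> 'v strategy"
  assumes "countable V"
    and "\<And>\<omega> h x. \<omega> \<in> space M \<Longrightarrow> \<sigma> \<omega> h = Query x \<Longrightarrow> x \<in> V"
    and "\<And>h. (\<lambda>\<omega>. \<sigma> \<omega> h) \<in> M \<rightarrow>\<^sub>M count_space UNIV"
  shows "(\<lambda>\<omega>. num_queries (\<sigma> \<omega>) r) \<in> borel_measurable M"
  unfolding num_queries_def
  by (intro borel_measurable_SUP measurable_compose[OF measurable_transcript[OF assms]]) auto

lemma randomized_search_not_bigo_log_dist:
  fixes M :: "'w measure" and A :: "'w \<Rightarrow> 'v::infinite algorithm"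
  assumes A: "randomized_search M A"
  shows "\<not> bigo_log_dist (expected_query_complexity M A)"
proof
  assume "bigo_log_dist (expected_query_complexity M A)"
  then obtain C :: real and d0 :: nat where bound:
    "\<And>T s t. finite_tree T \<Longrightarrow> s \<in> nodes T \<Longrightarrow> t \<in> nodes T \<Longrightarrow> d0 \<le> tree_dist T s t \<Longrightarrow>
       expected_query_complexity M A T s t \<le> ennreal (C * ln (real (tree_dist T s t)))"
    unfolding bigo_log_dist_def by blast
  \<comment> \<open>The factor 2 is the ratio of all \<open>2 ^ d\<close> leaves to the
    \<open>4 ^ k\<close> leaves guaranteed to cost \<open>k\<close> queries.\<close>
  have "eventually (\<lambda>k::nat. 2 * \<bar>C\<bar> * ln (real (2 * k + 1)) < real k) sequentially"
    by real_asymp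
  then have "eventually (\<lambda>k::nat. 2 * \<bar>C\<bar> * ln (real (2 * k + 1)) < real k \<and> d0 \<le> k) sequentially"
    by (intro eventually_conj eventually_ge_at_top)
  then obtain k :: nat where k: "2 * \<bar>C\<bar> * ln (real (2 * k + 1)) < real k" "d0 \<le> k"
    using eventually_happens by fastforce
  define d where "d = 2 * k + 1"
  obtain T :: "'v ugraph" and s L where T:
    "finite_tree T" "s \<in> nodes T" "L \<subseteq> nodes T" "card L = 2 ^ d"
    "\<And>t. t \<in> L \<Longrightarrow> tree_dist T s t = d"
    "\<And>x. x \<in> nodes T \<Longrightarrow> \<exists>S. finite S \<and> card S \<le> 4 \<and> (\<forall>t\<in>nodes T. respond T t x \<in> S)"
    using binary_tree_exists[of d] by blast
  interpret prob_space M
    using A by (simp add: randomized_search_def)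
  have fin: "finite (nodes T)" "finite L"
    using T(1,3) finite_subset by (auto simp: finite_tree_def)
  have det: "deterministic_search (A \<omega>)" if "\<omega> \<in> space M" for \<omega>
    using A that by (simp add: randomized_search_def)
  have query_in: "x \<in> nodes T" if "\<omega> \<in> space M" "A \<omega> T s h = Query x" for \<omega> h x
  proof -
    have "A \<omega> T s h \<in> Query ` nodes T \<union> Output ` nodes T"
      using det[OF that(1)] T(1,2) unfolding deterministic_search_def by blast
    then show ?thesis
      using that(2) by auto
  qed
  have meas: "(\<lambda>\<omega>. query_complexity (A \<omega>) T s t) \<in> borel_measurable M" for t
    unfolding query_complexity_def
  proof (rule borel_measurable_num_queries)
    show "countable (nodes T)"
      using fin by (simp add: countable_finite)
    show "(\<lambda>\<omega>. A \<omega> T s h) \<in> M \<rightarrow>\<^sub>M count_space UNIV" for h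
      using A T(1,2) unfolding randomized_search_def by blast
  qed (rule query_in)
  \<comment> \<open>\<open>4 ^ k\<close> is exactly half of the \<open>2 ^ d\<close> leaves, so at
    least half remain unfound within \<open>k\<close> queries.\<close>
  have pow: "(2::nat) ^ d - 4 ^ k = 4 ^ k"
    by (simp add: d_def power_mult)
  have "of_nat (k * 4 ^ k) \<le> (\<Sum>t\<in>L. query_complexity (A \<omega>) T s t)"
    if \<omega>: "\<omega> \<in> space M" for \<omega>
  proof -
    have "of_nat (k * (card L - 4 ^ k)) \<le> (\<Sum>t\<in>L. num_queries (A \<omega> T s) (respond T t))"
    proof (rule sum_num_queries_ge)
      show "\<exists>S. finite S \<and> card S \<le> 4 \<and> (\<forall>t\<in>L. respond T t x \<in> S)"
        if "A \<omega> T s h = Query x" for h x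
        using T(6)[OF query_in[OF \<omega> that]] T(3) by blast
      show "outputs (A \<omega> T s) (respond T t) t" if "t \<in> L" for t
        using det[OF \<omega>] T(1-3) that unfolding deterministic_search_def by blast
    qed (use fin in auto)
    then show ?thesis
      by (simp only: T(4) pow query_complexity_def)
  qed
  then have "(\<integral>\<^sup>+ \<omega>. of_nat (k * 4 ^ k) \<partial>M)
      \<le> (\<integral>\<^sup>+ \<omega>. (\<Sum>t\<in>L. query_complexity (A \<omega>) T s t) \<partial>M)"
    by (intro nn_integral_mono)
  then have "of_nat (k * 4 ^ k) \<le> (\<integral>\<^sup>+ \<omega>. (\<Sum>t\<in>L. query_complexity (A \<omega>) T s t) \<partial>M)"
    by (simp only: nn_integral_const emeasure_space_1 mult_1_right)
  \<comment> \<open>Exchanging sum and expectation turns the bound for each seed into one on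
    expected complexities, without singling out a leaf.\<close>
  also have "\<dots> = (\<Sum>t\<in>L. expected_query_complexity M A T s t)"
    unfolding expected_query_complexity_def by (rule nn_integral_sum) (rule meas)
  also have "\<dots> \<le> (\<Sum>t\<in>L. ennreal (\<bar>C\<bar> * ln (real d)))"
  proof (rule sum_mono)
    fix t assume t: "t \<in> L"
    have "expected_query_complexity M A T s t \<le> ennreal (C * ln (real d))"
      using bound[of T s t] T t k(2) by (auto simp: d_def)
    \<comment> \<open>\<open>C\<close> may be negative. With its absolute value and
      \<open>d \<ge> 1\<close> the bound is nonnegative, which permits the later return from
      \<open>ennreal\<close> to the reals.\<close>
    also have "\<dots> \<le> ennreal (\<bar>C\<bar> * ln (real d))"
      by (intro ennreal_leI mult_right_mono) (auto simp: d_def)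
    finally show "expected_query_complexity M A T s t \<le> ennreal (\<bar>C\<bar> * ln (real d))" .
  qed
  also have "\<dots> = ennreal (2 ^ d * (\<bar>C\<bar> * ln (real d)))"
    by (simp add: T(4) ennreal_mult d_def flip: ennreal_numeral ennreal_power)
  finally have "ennreal (real (k * 4 ^ k)) \<le> ennreal (2 ^ d * (\<bar>C\<bar> * ln (real d)))"
    by (simp only: ennreal_of_nat_eq_real_of_nat)
  then have "real (k * 4 ^ k) \<le> 2 ^ d * (\<bar>C\<bar> * ln (real d))"
    by (subst (asm) ennreal_le_iff) (auto simp: d_def)
  also have "\<dots> = 4 ^ k * (2 * \<bar>C\<bar> * ln (real (2 * k + 1)))"
    by (simp add: d_def power_mult)
  also have "\<dots> < 4 ^ k * real k"
    using k(1) by (intro mult_strict_left_mono) auto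
  finally show False
    by simp
qed

text \<open>A deterministic algorithm is a randomized one that ignores its seed.\<close>

lemma deterministic_search_not_bigo_log_dist:
  fixes A :: "'v::infinite algorithm"
  assumes "deterministic_search A"
  shows "\<not> bigo_log_dist (query_complexity A)"
proof -
  let ?M = "return (count_space UNIV) ()"
  interpret prob_space ?M
    by (rule prob_space_return) simp
  have "randomized_search ?M (\<lambda>_. A)"
    using assms prob_space_axioms by (simp add: randomized_search_def)
  moreover have "expected_query_complexity ?M (\<lambda>_. A) = query_complexity A"
    by (intro ext) (simp add: expected_query_complexity_def emeasure_space_1)
  ultimately show ?thesis
    using randomized_search_not_bigo_log_dist[of ?M "\<lambda>_. A"] by simp
qed

theorem theorem1:
  shows "(\<nexists>A :: 'v::infinite algorithm.
            deterministic_search A \<and> bigo_log_dist (query_complexity A)) \<and>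
         (\<nexists>(M :: 'w measure) (A :: 'w \<Rightarrow> 'v algorithm).
            randomized_search M A \<and> bigo_log_dist (expected_query_complexity M A))"
  using deterministic_search_not_bigo_log_dist randomized_search_not_bigo_log_dist by blast

end
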